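(* Let $x_1,\dots,x_n\in\mathbb{R}^{d+1}$ be demand points (each with $0$-th coordinate equal to $1$), let $\lambda\in\mathbb{R}^n$ with $0\le\lambda_1\le\dots\le\lambda_n$, let $p=\frac{r}{s}\in\mathbb{Q}$ with $r>s$ positive integers, $\gcd(r,s)=1$, and let $\|\cdot\|$ be a norm on $\mathbb{R}^d$ with dual norm $\|\cdot\|^*$. Then the fitting hyperplane problem $$\min_{\beta}\ \sum_{i=1}^n\lambda_i\,\varepsilon_{(i)}(\beta)^p$$ with residuals $\varepsilon_{x_i}(\beta)=\min_{y\in\mathcal H(\beta)}\|(x_i)_{-0}-y\|$ is equivalent to the following mathematical programming problem in the variables $\beta\in\mathbb{R}^{d+1}$ (with $\beta_{-0}\ne0$), $\varepsilon\in\mathbb{R}^n$, $z\in\mathbb{R}^n_+$, $v,w\in\mathbb{R}^n$: $$\begin{aligned} \min\ & \sum_{j=1}^n v_j+\sum_{i=1}^n w_i\\ \text{s.t. } & \varepsilon_i\ \ge\ \frac{|\beta^t x_i|}{\|\beta_{-0}\|^*}, && i=1,\dots,n,\\ & z_i^s\ge\varepsilon_i^r, && i=1,\dots,n,\\ & v_j+w_i\ge\lambda_i z_j, && i,j=1,\dots,n. \end{aligned}$$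
   Context: Vectors in $\mathbb{R}^{d+1}$ are indexed $0,1,\dots,d$; for $y\in\mathbb{R}^{d+1}$, $y_{-0}=(y_1,\dots,y_d)$. Demand points $x\in\mathbb{R}^{d+1}$ have $0$-th coordinate $1$, the actual point in $\mathbb{R}^d$ being $x_{-0}$. For $\beta\in\mathbb{R}^{d+1}$ with $\beta_{-0}\ne0$, $\mathcal H(\beta)=\{y\in\mathbb{R}^d:\ (1,y^t)\beta=0\}$. The dual norm is $\|u\|^*=\max_{\|v\|\le1}u^tv$. For residuals $\varepsilon_{x_1}(\beta),\dots,\varepsilon_{x_n}(\beta)$, $\varepsilon_{(1)}(\beta)\le\dots\le\varepsilon_{(n)}(\beta)$ denotes the same values sorted in nondecreasing order. "Equivalent" means: both problems have the same optimal value, and $\beta$ is optimal for the fitting hyperplane problem if and only if it is the $\beta$-component of an optimal solution of the mathematical program. *)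

theory Defs
  imports "HOL-Analysis.Analysis"
begin

text \<open>The norm of the type class is the Euclidean one on \<open>real ^ 'd\<close>; an arbitrary norm is a
  function with the following property.\<close>

definition is_norm :: "('a::real_vector \<Rightarrow> real) \<Rightarrow> bool" where
  "is_norm N \<longleftrightarrow>
     (\<forall>u. 0 \<le> N u) \<and>
     (\<forall>u. N u = 0 \<longleftrightarrow> u = 0) \<and>
     (\<forall>c u. N (c *\<^sub>R u) = \<bar>c\<bar> * N u) \<and>
     (\<forall>u v. N (u + v) \<le> N u + N v)"

text \<open>The supremum is a maximum, see \<open>dual_norm_is_max\<close> below.\<close>

definition dual_norm :: "(real ^ 'd \<Rightarrow> real) \<Rightarrow> real ^ 'd \<Rightarrow> real" where
  "dual_norm N u = (SUP v\<in>{v. N v \<le> 1}. u \<bullet> v)"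

text \<open>For \<open>d = CARD('d)\<close>, the type \<open>real ^ 'd option\<close> plays the role of the space of dimension
  \<open>d + 1\<close>: the index \<open>None\<close> is the index \<open>0\<close>, and the indices \<open>Some j\<close> are \<open>1, \<dots>, d\<close>.\<close>

definition drop0 :: "real ^ ('d::finite) option \<Rightarrow> real ^ 'd" where
  "drop0 y = (\<chi> j. y $ Some j)"

definition cons1 :: "real ^ 'd \<Rightarrow> real ^ ('d::finite) option" where
  "cons1 y = (\<chi> k. case k of None \<Rightarrow> 1 | Some j \<Rightarrow> y $ j)"

definition hyperplane :: "real ^ ('d::finite) option \<Rightarrow> (real ^ 'd) set" where
  "hyperplane \<beta> = {y. cons1 y \<bullet> \<beta> = 0}"

text \<open>If \<open>drop0 \<beta> \<noteq> 0\<close> then the infimum is a minimum, see \<open>residual_is_min\<close> below.\<close>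

definition residual ::
  "(real ^ 'd \<Rightarrow> real) \<Rightarrow> real ^ ('d::finite) option \<Rightarrow> real ^ 'd option \<Rightarrow> real" where
  "residual N \<beta> x = (INF y\<in>hyperplane \<beta>. N (drop0 x - y))"

text \<open>A minimization problem is given by its feasible set and its objective. The optimal value is
  taken in the extended reals; optimal solutions are expressed by \<^const>\<open>is_arg_min\<close>.\<close>

definition opt_value :: "'a set \<Rightarrow> ('a \<Rightarrow> real) \<Rightarrow> ereal" where
  "opt_value F f = (INF a\<in>F. ereal (f a))"

text \<open>\<open>\<pi>\<close> extracts from a solution of the second problem its component in the variables of the
  first one.\<close>

definition equivalent_problems ::
  "'a set \<Rightarrow> ('a \<Rightarrow> real) \<Rightarrow> 'b set \<Rightarrow> ('b \<Rightarrow> real) \<Rightarrow> ('b \<Rightarrow> 'a) \<Rightarrow> bool" where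
  "equivalent_problems F f G g \<pi> \<longleftrightarrow>
     opt_value F f = opt_value G g \<and>
     (\<forall>a. is_arg_min f (\<lambda>a. a \<in> F) a \<longleftrightarrow> (\<exists>b. is_arg_min g (\<lambda>b. b \<in> G) b \<and> \<pi> b = a))"

text \<open>A vector of length \<open>n\<close> is a function on \<open>nat\<close> of which only the values on \<open>{1..n}\<close> matter.
  \<open>order_stat n e i\<close> is the \<open>i\<close>-th smallest of \<open>e 1, \<dots>, e n\<close>, repetitions included.\<close>

definition order_stat :: "nat \<Rightarrow> (nat \<Rightarrow> real) \<Rightarrow> nat \<Rightarrow> real" where
  "order_stat n e i = sort (map e [1..<Suc n]) ! (i - 1)"

definition fit_feasible :: "(real ^ ('d::finite) option) set" where
  "fit_feasible = {\<beta>. drop0 \<beta> \<noteq> 0}"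

definition fit_objective ::
  "(real ^ 'd \<Rightarrow> real) \<Rightarrow> nat \<Rightarrow> (nat \<Rightarrow> real) \<Rightarrow> rat \<Rightarrow> (nat \<Rightarrow> real ^ ('d::finite) option)
    \<Rightarrow> real ^ 'd option \<Rightarrow> real" where
  "fit_objective N n lam p x \<beta> =
     (\<Sum>i=1..n. lam i * order_stat n (\<lambda>k. residual N \<beta> (x k)) i powr of_rat p)"

type_synonym 'd mp_point =
  "(real ^ 'd option) \<times> (nat \<Rightarrow> real) \<times> (nat \<Rightarrow> real) \<times> (nat \<Rightarrow> real) \<times> (nat \<Rightarrow> real)"

definition mp_feasible ::
  "(real ^ 'd \<Rightarrow> real) \<Rightarrow> nat \<Rightarrow> (nat \<Rightarrow> real) \<Rightarrow> nat \<Rightarrow> nat \<Rightarrow> (nat \<Rightarrow> real ^ ('d::finite) option)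
    \<Rightarrow> 'd mp_point set" where
  "mp_feasible N n lam r s x =
     {(\<beta>, \<epsilon>, z, v, w).
        drop0 \<beta> \<noteq> 0 \<and>
        (\<forall>i\<in>{1..n}. 0 \<le> z i) \<and>
        (\<forall>i\<in>{1..n}. \<epsilon> i \<ge> \<bar>\<beta> \<bullet> x i\<bar> / dual_norm N (drop0 \<beta>)) \<and>
        (\<forall>i\<in>{1..n}. z i ^ s \<ge> \<epsilon> i ^ r) \<and>
        (\<forall>i\<in>{1..n}. \<forall>j\<in>{1..n}. v j + w i \<ge> lam i * z j)}"

definition mp_objective :: "nat \<Rightarrow> ('d::finite) mp_point \<Rightarrow> real" where
  "mp_objective n = (\<lambda>(\<beta>, \<epsilon>, z, v, w). (\<Sum>j=1..n. v j) + (\<Sum>i=1..n. w i))"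

lemma is_normD:
  assumes "is_norm N"
  shows "0 \<le> N u" and "N u = 0 \<longleftrightarrow> u = 0" and "N (c *\<^sub>R u) = \<bar>c\<bar> * N u"
    and "N (u + v) \<le> N u + N v"
  using assms by (auto simp: is_norm_def)

lemma is_norm_continuous:
  fixes N :: "'a::euclidean_space \<Rightarrow> real"
  assumes "is_norm N"
  shows "continuous_on S N"
proof -
  have "convex_on UNIV N"
  proof (rule convex_onI)
    fix t :: real and a b :: 'a
    assume "0 < t" "t < 1"
    then show "N ((1 - t) *\<^sub>R a + t *\<^sub>R b) \<le> (1 - t) * N a + t * N b"
      using is_normD(4)[OF assms, of "(1 - t) *\<^sub>R a" "t *\<^sub>R b"]
      by (simp add: is_normD(3)[OF assms])
  qed simp
  then have "continuous_on UNIV N"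
    by (intro convex_on_continuous) auto
  then show ?thesis
    using continuous_on_subset by blast
qed

lemma is_norm_lower_bound:
  fixes N :: "'a::euclidean_space \<Rightarrow> real"
  assumes "is_norm N"
  obtains c where "c > 0" "\<And>u. c * norm u \<le> N u"
proof -
  have "compact (sphere (0::'a) 1)" "sphere (0::'a) 1 \<noteq> {}"
    by auto
  then obtain a where a: "a \<in> sphere 0 1" "\<And>b. b \<in> sphere 0 1 \<Longrightarrow> N a \<le> N b"
    using continuous_attains_inf[OF _ _ is_norm_continuous[OF assms]] by metis
  have "a \<noteq> 0"
    using a(1) by auto
  then have "N a > 0"
    using is_normD(1,2)[OF assms, of a] by linarith
  moreover have "N a * norm u \<le> N u" for u
  proof (cases "u = 0")
    case True
    then show ?thesis using is_normD(1)[OF assms, of u] by simp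
  next
    case False
    then have "u /\<^sub>R norm u \<in> sphere 0 1"
      by simp
    from a(2)[OF this] have "N a \<le> N u / norm u"
      by (simp add: is_normD(3)[OF assms] divide_inverse mult.commute)
    then show ?thesis
      using False by (simp add: field_simps)
  qed
  ultimately show ?thesis
    using that by blast
qed

lemma is_norm_compact_sublevel:
  fixes N :: "'a::euclidean_space \<Rightarrow> real"
  assumes "is_norm N"
  shows "compact {u. N (a - u) \<le> t}"
proof -
  obtain c where c: "c > 0" "\<And>u. c * norm u \<le> N u"
    using is_norm_lower_bound[OF assms] by blast
  have "{u. N (a - u) \<le> t} \<subseteq> cball a (t / c)"
  proof
    fix u assume "u \<in> {u. N (a - u) \<le> t}"
    then have "c * norm (a - u) \<le> t"
      using c(2)[of "a - u"] by simp
    then show "u \<in> cball a (t / c)"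
      using c(1) by (simp add: dist_norm field_simps)
  qed
  moreover have "closed {u. N (a - u) \<le> t}"
    by (intro closed_Collect_le continuous_on_const
        continuous_on_compose2[OF is_norm_continuous[OF assms, of UNIV]] continuous_intros) auto
  ultimately show ?thesis
    using bounded_subset[OF bounded_cball] compact_eq_bounded_closed by metis
qed

lemma dual_norm_is_max:
  assumes "is_norm N"
  shows "\<exists>v. N v \<le> 1 \<and> dual_norm N u = u \<bullet> v \<and> (\<forall>v'. N v' \<le> 1 \<longrightarrow> u \<bullet> v' \<le> u \<bullet> v)"
proof -
  have N0: "N (0 - v) = N v" for v
    using is_normD(3)[OF assms, of "-1" v] by simp
  have "compact {v. N v \<le> 1}"
    using is_norm_compact_sublevel[OF assms, of 0 1] unfolding N0 .
  moreover have "{v. N v \<le> 1} \<noteq> {}"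
    using is_normD(2)[OF assms, of 0] by (auto intro!: exI[of _ 0])
  moreover have "continuous_on {v. N v \<le> 1} ((\<bullet>) u)"
    by (intro continuous_intros)
  ultimately obtain v where v: "v \<in> {v. N v \<le> 1}" "\<And>v'. v' \<in> {v. N v \<le> 1} \<Longrightarrow> u \<bullet> v' \<le> u \<bullet> v"
    using continuous_attains_sup by metis
  have "dual_norm N u = u \<bullet> v"
    unfolding dual_norm_def using v by (intro cSup_eq_maximum) auto
  then show ?thesis
    using v by auto
qed

lemma cons1_inner: "cons1 y \<bullet> \<beta> = \<beta> $ None + y \<bullet> drop0 \<beta>"
  by (simp add: inner_vec_def cons1_def drop0_def UNIV_option_conv sum.reindex)

lemma residual_is_min:
  assumes "is_norm N" and "drop0 \<beta> \<noteq> 0"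
  shows "\<exists>y\<in>hyperplane \<beta>. residual N \<beta> x = N (drop0 x - y) \<and>
           (\<forall>y'\<in>hyperplane \<beta>. N (drop0 x - y) \<le> N (drop0 x - y'))"
proof -
  let ?a = "drop0 x"
  define y0 where "y0 = (- (\<beta> $ None) / (drop0 \<beta> \<bullet> drop0 \<beta>)) *\<^sub>R drop0 \<beta>"
  have y0: "y0 \<in> hyperplane \<beta>"
    using assms(2) by (simp add: hyperplane_def cons1_inner y0_def)
  let ?K = "{y. N (?a - y) \<le> N (?a - y0)} \<inter> hyperplane \<beta>"
  have "closed (hyperplane \<beta>)"
    unfolding hyperplane_def cons1_inner by (intro closed_Collect_eq continuous_intros)
  then have "compact ?K"
    by (intro compact_Int_closed is_norm_compact_sublevel assms(1))
  moreover have "?K \<noteq> {}"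
    using y0 by auto
  moreover have "continuous_on ?K (\<lambda>y. N (?a - y))"
    by (intro continuous_on_compose2[OF is_norm_continuous[OF assms(1), of UNIV]]
        continuous_intros) auto
  ultimately obtain y where y: "y \<in> ?K" "\<And>y'. y' \<in> ?K \<Longrightarrow> N (?a - y) \<le> N (?a - y')"
    using continuous_attains_inf by metis
  have min: "N (?a - y) \<le> N (?a - y')" if "y' \<in> hyperplane \<beta>" for y'
    using y(1) y(2)[of y'] that by (cases "N (?a - y') \<le> N (?a - y0)") auto
  have "residual N \<beta> x = N (?a - y)"
    unfolding residual_def using y(1) min by (intro cInf_eq_minimum) auto
  then show ?thesis
    using y(1) min by auto
qed

end

theory Submission
  imports Defs
begin

text \<open>The residual has the closed form \<open>\<bar>\<beta> \<bullet> x\<bar> / \<parallel>\<beta>\<^sub>-\<^sub>0\<parallel>\<^sup>*\<close>, by duality of norms. Since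
  \<open>\<lambda>\<close> is nondecreasing, \<open>\<Sum>\<^sub>i \<lambda>\<^sub>i z\<^sub>(\<^sub>i\<^sub>)\<close> is the value of the assignment problem with profits
  \<open>\<lambda>\<^sub>i z\<^sub>j\<close>, whose linear programming dual is the minimization over \<open>v\<close> and \<open>w\<close>. An optimal
  dual solution is explicit: for sorted \<open>a\<close>, take \<open>v\<^sub>j - v\<^sub>j\<^sub>-\<^sub>1 = \<lambda>\<^sub>j (a\<^sub>j - a\<^sub>j\<^sub>-\<^sub>1)\<close> and
  \<open>w\<^sub>i = \<lambda>\<^sub>i a\<^sub>i - v\<^sub>i\<close>.\<close>

text \<open>Projection bounds the value of \<open>F\<close> by that of \<open>G\<close>, and lifting
  gives the converse. An optimal \<open>b\<close> projects to an optimal point because it is no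
  worse than the lift of any competitor.\<close>

lemma equivalent_problemsI:
  assumes "\<And>b. b \<in> G \<Longrightarrow> \<pi> b \<in> F \<and> f (\<pi> b) \<le> g b"
    and "\<And>a. a \<in> F \<Longrightarrow> \<exists>b\<in>G. \<pi> b = a \<and> g b = f a"
  shows "equivalent_problems F f G g \<pi>"
  unfolding equivalent_problems_def
proof (intro conjI allI)
  show "opt_value F f = opt_value G g"
    unfolding opt_value_def
  proof (rule antisym)
    show "(INF a\<in>F. ereal (f a)) \<le> (INF b\<in>G. ereal (g b))"
    proof (rule INF_mono)
      fix b assume "b \<in> G"
      with assms(1)[OF this] show "\<exists>a\<in>F. ereal (f a) \<le> ereal (g b)"
        by auto
    qed
    show "(INF b\<in>G. ereal (g b)) \<le> (INF a\<in>F. ereal (f a))"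
    proof (rule INF_mono)
      fix a assume "a \<in> F"
      with assms(2)[OF this] show "\<exists>b\<in>G. ereal (g b) \<le> ereal (f a)"
        by force
    qed
  qed
next
  fix a
  show "is_arg_min f (\<lambda>a. a \<in> F) a \<longleftrightarrow> (\<exists>b. is_arg_min g (\<lambda>b. b \<in> G) b \<and> \<pi> b = a)"
  proof
    assume a: "is_arg_min f (\<lambda>a. a \<in> F) a"
    then obtain b where "b \<in> G" "\<pi> b = a" "g b = f a"
      using assms(2) by (auto simp: is_arg_min_linorder)
    moreover have "f a \<le> g b'" if "b' \<in> G" for b'
      using a assms(1)[OF that] order_trans by (fastforce simp: is_arg_min_linorder)
    ultimately show "\<exists>b. is_arg_min g (\<lambda>b. b \<in> G) b \<and> \<pi> b = a"
      by (auto simp: is_arg_min_linorder)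
  next
    assume "\<exists>b. is_arg_min g (\<lambda>b. b \<in> G) b \<and> \<pi> b = a"
    then obtain b where b: "b \<in> G" "\<And>b'. b' \<in> G \<Longrightarrow> g b \<le> g b'" "\<pi> b = a"
      by (auto simp: is_arg_min_linorder)
    have "f a \<le> f a'" if a': "a' \<in> F" for a'
    proof -
      obtain b' where "b' \<in> G" "g b' = f a'"
        using assms(2)[OF a'] by blast
      then show ?thesis
        using b(2)[of b'] assms(1)[OF b(1)] b(3) by simp
    qed
    then show "is_arg_min f (\<lambda>a. a \<in> F) a"
      using assms(1)[OF b(1)] b(3) by (auto simp: is_arg_min_linorder)
  qed
qed

section \<open>Residuals and the dual norm\<close>

lemma inner_le_dual_norm:
  assumes "is_norm N"
  shows "\<bar>u \<bullet> v\<bar> \<le> dual_norm N u * N v"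
proof (cases "v = 0")
  case True
  then show ?thesis using is_normD(2)[OF assms, of 0] by simp
next
  case False
  then have pos: "N v > 0"
    using is_normD(1,2)[OF assms, of v] by linarith
  obtain m where m: "dual_norm N u = u \<bullet> m" "\<And>v'. N v' \<le> 1 \<Longrightarrow> u \<bullet> v' \<le> u \<bullet> m"
    using dual_norm_is_max[OF assms] by metis
  \<comment> \<open>Scaling by \<open>1 / N v\<close> puts \<open>v\<close> into the unit ball; the
    sign turns the inner product into its absolute value.\<close>
  define t where "t = sgn (u \<bullet> v) / N v"
  have "N (t *\<^sub>R v) \<le> 1"
    using pos by (simp add: is_normD(3)[OF assms] t_def abs_divide sgn_if)
  from m(2)[OF this] have "\<bar>u \<bullet> v\<bar> / N v \<le> dual_norm N u"
    by (simp add: m(1) t_def abs_sgn mult.commute)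
  then show ?thesis
    using pos by (simp add: field_simps)
qed

lemma dual_norm_pos:
  assumes "is_norm N" and "u \<noteq> 0"
  shows "0 < dual_norm N u"
proof -
  have "0 < u \<bullet> u"
    using assms(2) by simp
  also have "\<dots> \<le> dual_norm N u * N u"
    using inner_le_dual_norm[OF assms(1), of u u] by simp
  finally show ?thesis
    using is_normD(1)[OF assms(1), of u] by (simp add: zero_less_mult_iff)
qed

text \<open>All points \<open>y\<close> of the hyperplane give the same value of
  \<open>?u \<bullet> (?a - y)\<close>, so the dual norm inequality bounds every distance below.
  Moving from \<open>?a\<close> along a direction \<open>m\<close> that attains the dual norm
  reaches the bound.\<close>

lemma residual_eq:
  assumes N: "is_norm N" and \<beta>: "drop0 \<beta> \<noteq> 0" and x: "x $ None = 1"
  shows "residual N \<beta> x = \<bar>\<beta> \<bullet> x\<bar> / dual_norm N (drop0 \<beta>)"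
proof -
  let ?u = "drop0 \<beta>" and ?a = "drop0 x"
  let ?D = "dual_norm N ?u"
  have D: "?D > 0"
    using dual_norm_pos[OF N \<beta>] .
  have "x = cons1 ?a"
    using x by (auto simp: vec_eq_iff cons1_def drop0_def split: option.split)
  then have c: "\<beta> \<bullet> x = \<beta> $ None + ?a \<bullet> ?u"
    by (metis cons1_inner inner_commute)
  obtain y where y: "y \<in> hyperplane \<beta>" "residual N \<beta> x = N (?a - y)"
    "\<And>y'. y' \<in> hyperplane \<beta> \<Longrightarrow> N (?a - y) \<le> N (?a - y')"
    using residual_is_min[OF N \<beta>] by metis
  have "?u \<bullet> (?a - y) = \<beta> \<bullet> x"
    using y(1) unfolding c hyperplane_def cons1_inner mem_Collect_eq
    by (simp add: inner_diff_right inner_commute[of ?u])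
  with inner_le_dual_norm[OF N, of ?u "?a - y"]
  have ge: "\<bar>\<beta> \<bullet> x\<bar> / ?D \<le> N (?a - y)"
    using D by (simp add: field_simps)
  obtain m where m: "N m \<le> 1" "?D = ?u \<bullet> m"
    using dual_norm_is_max[OF N] by metis
  \<comment> \<open>The step length for which \<open>?a - t *\<^sub>R m\<close> lands on the
    hyperplane.\<close>
  define t where "t = (\<beta> \<bullet> x) / ?D"
  have "t * (m \<bullet> ?u) = \<beta> \<bullet> x"
    using D m(2) by (simp add: t_def inner_commute)
  then have "?a - t *\<^sub>R m \<in> hyperplane \<beta>"
    using c by (simp add: hyperplane_def cons1_inner inner_diff_left)
  from y(3)[OF this] have "N (?a - y) \<le> \<bar>t\<bar> * N m"
    by (simp add: is_normD(3)[OF N])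
  also have "\<dots> \<le> \<bar>t\<bar>"
    using m(1) by (simp add: mult_left_le)
  also have "\<dots> = \<bar>\<beta> \<bullet> x\<bar> / ?D"
    using D by (simp add: t_def abs_divide)
  finally show ?thesis
    using ge y(2) by linarith
qed

section \<open>Sorting and duality for the assignment problem\<close>

lemma sorting_bijection:
  obtains q where "bij_betw q {1..n} {1..n}"
    and "\<And>i. i \<in> {1..n} \<Longrightarrow> order_stat n e i = e (q i)"
    and "mono_on {1..n} (e \<circ> q)"
proof
  \<comment> \<open>Sorting the indices by \<open>e\<close>, rather than the values, keeps the
    permutation even if values repeat.\<close>
  define L where "L = sort_key e [1..<Suc n]"
  have len: "length L = n"
    by (simp add: L_def)
  have sorted: "sorted (map e L)"
    by (simp add: L_def)
  have map: "sort (map e [1..<Suc n]) = map e L"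
    by (rule properties_for_sort) (simp_all add: L_def)
  have "bij_betw (\<lambda>i. i - 1) {1..n} {..<n}"
    by (rule bij_betw_byWitness[where f' = Suc]) auto
  moreover have "bij_betw ((!) L) {..<n} {1..n}"
    by (rule bij_betw_nth) (auto simp: L_def)
  ultimately show "bij_betw ((!) L \<circ> (\<lambda>i. i - 1)) {1..n} {1..n}"
    by (rule bij_betw_trans)
  show "order_stat n e i = e (((!) L \<circ> (\<lambda>i. i - 1)) i)" if "i \<in> {1..n}" for i
    using that len unfolding order_stat_def map o_def by (intro nth_map) auto
  show "mono_on {1..n} (e \<circ> ((!) L \<circ> (\<lambda>i. i - 1)))"
  proof (rule mono_onI)
    fix i j assume "i \<in> {1..n}" "j \<in> {1..n}" "i \<le> j"
    then show "(e \<circ> ((!) L \<circ> (\<lambda>i. i - 1))) i \<le> (e \<circ> ((!) L \<circ> (\<lambda>i. i - 1))) j"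
      using sorted_nth_mono[OF sorted, of "i - 1" "j - 1"] len by simp
  qed
qed

text \<open>Add up the constraints for the pairs \<open>(i, q i)\<close>. No sortedness is involved:
  any permutation gives a lower bound.\<close>

lemma assignment_weak_duality:
  fixes lam z v w :: "nat \<Rightarrow> real"
  assumes "bij_betw q I I"
    and "\<forall>i\<in>I. \<forall>j\<in>I. lam i * z j \<le> v j + w i"
  shows "(\<Sum>i\<in>I. lam i * z (q i)) \<le> (\<Sum>j\<in>I. v j) + (\<Sum>i\<in>I. w i)"
proof -
  have "(\<Sum>i\<in>I. lam i * z (q i)) \<le> (\<Sum>i\<in>I. v (q i) + w i)"
    using assms by (intro sum_mono) (auto dest: bij_betwE)
  also have "\<dots> = (\<Sum>j\<in>I. v j) + (\<Sum>i\<in>I. w i)"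
    using sum.reindex_bij_betw[OF assms(1), of v] by (simp add: sum.distrib)
  finally show ?thesis .
qed

text \<open>The potential \<open>v\<close> is a discrete integral of \<open>lam\<close> against the
  increments of \<open>a\<close>. As \<open>lam\<close> is nondecreasing, \<open>v\<close> is convex
  as a function of \<open>a\<close>, and the claim is the subgradient inequality with slope
  \<open>lam i\<close> at \<open>a i\<close>.\<close>

lemma sorted_potential:
  fixes lam a :: "nat \<Rightarrow> real"
  assumes lam: "mono_on {1..n} lam" and a: "mono_on {1..n} a"
  obtains v where "\<And>i j. i \<in> {1..n} \<Longrightarrow> j \<in> {1..n} \<Longrightarrow> lam i * (a j - a i) \<le> v j - v i"
proof
  \<comment> \<open>Starting at 2 gives \<open>v 1 = 0\<close> and avoids \<open>a 0\<close>, which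
    lies outside the range of monotonicity.\<close>
  define v where "v j = (\<Sum>k=2..j. lam k * (a k - a (k - 1)))" for j
  have v_Suc: "v (Suc j) = v j + lam (Suc j) * (a (Suc j) - a j)" if "1 \<le> j" for j
    using that by (simp add: v_def)
  have a_Suc: "0 \<le> a (Suc j) - a j" if "1 \<le> j" "Suc j \<le> n" for j
    using that mono_onD[OF a, of j "Suc j"] by simp
  \<comment> \<open>To the right of \<open>i\<close> every increment carries a weight of at least
    \<open>lam i\<close>; to the left, in \<open>down\<close>, at most \<open>lam i\<close>.\<close>
  have up: "lam i * (a j - a i) \<le> v j - v i" if "1 \<le> i" "i \<le> j" "j \<le> n" for i j
    using that(2,3)
  proof (induction j rule: dec_induct)
    case (step j)
    have "lam i * (a (Suc j) - a j) \<le> lam (Suc j) * (a (Suc j) - a j)"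
      using step that(1) by (intro mult_right_mono a_Suc mono_onD[OF lam]) auto
    then show ?case
      using step that(1) v_Suc[of j] by (simp add: algebra_simps)
  qed simp
  have down: "v i - v j \<le> lam i * (a i - a j)" if "1 \<le> j" "j \<le> i" "i \<le> n" for i j
    using that(2,1)
  proof (induction j rule: inc_induct)
    case (step j)
    have "lam (Suc j) * (a (Suc j) - a j) \<le> lam i * (a (Suc j) - a j)"
      using step that(3) by (intro mult_right_mono a_Suc mono_onD[OF lam]) auto
    then show ?case
      using step v_Suc[of j] by (simp add: algebra_simps)
  qed simp
  show "lam i * (a j - a i) \<le> v j - v i" if "i \<in> {1..n}" "j \<in> {1..n}" for i j
    using that up[of i j] down[of j i] by (cases "i \<le> j") (auto simp: algebra_simps)
qed

lemma assignment_strong_duality: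
  fixes lam z :: "nat \<Rightarrow> real"
  assumes q: "bij_betw q {1..n} {1..n}"
    and lam: "mono_on {1..n} lam" and z: "mono_on {1..n} (z \<circ> q)"
  obtains v w where "\<forall>i\<in>{1..n}. \<forall>j\<in>{1..n}. lam i * z j \<le> v j + w i"
    and "(\<Sum>j=1..n. v j) + (\<Sum>i=1..n. w i) = (\<Sum>i=1..n. lam i * z (q i))"
proof -
  obtain u where u: "\<And>i j. i \<in> {1..n} \<Longrightarrow> j \<in> {1..n} \<Longrightarrow>
      lam i * (z (q j) - z (q i)) \<le> u j - u i"
    using sorted_potential[OF lam z] unfolding o_def by blast
  define v where "v j = u (the_inv_into {1..n} q j)" for j
  \<comment> \<open>This makes the constraint for the pair \<open>(i, q i)\<close> tight, which
    gives equality of the sums.\<close>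
  define w where "w i = lam i * z (q i) - u i" for i
  have v_q: "v (q j) = u j" if "j \<in> {1..n}" for j
    using that q by (simp add: v_def the_inv_into_f_f bij_betw_def)
  show ?thesis
  proof
    show "\<forall>i\<in>{1..n}. \<forall>j\<in>{1..n}. lam i * z j \<le> v j + w i"
    proof (intro ballI)
      fix i j assume i: "i \<in> {1..n}" and "j \<in> {1..n}"
      then obtain k where "k \<in> {1..n}" "j = q k"
        using q unfolding bij_betw_def by (metis imageE)
      then show "lam i * z j \<le> v j + w i"
        using u[OF i, of k] v_q by (simp add: w_def algebra_simps)
    qed
    have "(\<Sum>j=1..n. v j) = (\<Sum>j=1..n. u j)"
      using sum.reindex_bij_betw[OF q, of v] v_q by simp
    then show "(\<Sum>j=1..n. v j) + (\<Sum>i=1..n. w i) = (\<Sum>i=1..n. lam i * z (q i))"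
      by (simp add: w_def sum_subtractf)
  qed
qed

lemma powr_quotient_power:
  fixes e :: real
  assumes "0 \<le> e" and "0 < s" and "0 < r"
  shows "(e powr (real r / real s)) ^ s = e ^ r"
\<comment> \<open>Zero is separate because \<open>powr_realpow\<close> needs a positive base; there
  both sides vanish since \<open>r\<close> and \<open>s\<close> are positive.\<close>
proof (cases "e = 0")
  case False
  then have "(e powr (real r / real s)) ^ s = e powr (real r / real s * real s)"
    using assms by (simp add: powr_powr flip: powr_realpow)
  then show ?thesis
    using False assms by (simp add: powr_realpow)
qed (use assms in \<open>simp add: zero_power\<close>)

section \<open>Projecting and lifting feasible points\<close>

theorem theorem6:
  fixes N :: "real ^ ('d::finite) \<Rightarrow> real"
    and x :: "nat \<Rightarrow> real ^ 'd option"
    and lam :: "nat \<Rightarrow> real"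
    and n r s :: nat
    and p :: rat
  assumes "is_norm N"
    and "\<forall>i\<in>{1..n}. x i $ None = 1"
    and "\<forall>i\<in>{1..n}. 0 \<le> lam i"
    and "mono_on {1..n} lam"
    and "p = of_nat r / of_nat s"
    and "0 < s" and "s < r" and "coprime r s"
  shows "equivalent_problems
           fit_feasible (fit_objective N n lam p x)
           (mp_feasible N n lam r s x) (mp_objective n)
           (\<lambda>(\<beta>, \<epsilon>, z, v, w). \<beta>)"
proof (rule equivalent_problemsI, goal_cases)
  let ?e = "\<lambda>\<beta> k. residual N \<beta> (x k)"
  have p: "of_rat p = real r / real s"
    by (simp add: assms(5) of_rat_divide)
  have r: "0 < r"
    using assms(7) by simp
  have res: "?e \<beta> k = \<bar>\<beta> \<bullet> x k\<bar> / dual_norm N (drop0 \<beta>)" "0 \<le> ?e \<beta> k"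
    if "drop0 \<beta> \<noteq> 0" "k \<in> {1..n}" for \<beta> k
    using residual_eq[OF assms(1) that(1)] assms(2) that dual_norm_pos[OF assms(1) that(1)]
    by simp_all
  note pow = powr_quotient_power[OF _ assms(6) r]
  {
    case (1 b)
    obtain \<beta> \<epsilon> z v w where b: "b = (\<beta>, \<epsilon>, z, v, w)"
      by (cases b)
    have \<beta>: "drop0 \<beta> \<noteq> 0" and z: "\<forall>i\<in>{1..n}. 0 \<le> z i"
      and \<epsilon>: "\<forall>i\<in>{1..n}. \<epsilon> i \<ge> \<bar>\<beta> \<bullet> x i\<bar> / dual_norm N (drop0 \<beta>)"
      and z\<epsilon>: "\<forall>i\<in>{1..n}. z i ^ s \<ge> \<epsilon> i ^ r"
      and vw: "\<forall>i\<in>{1..n}. \<forall>j\<in>{1..n}. lam i * z j \<le> v j + w i"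
      using 1 by (auto simp: b mp_feasible_def)
    obtain q where q: "bij_betw q {1..n} {1..n}"
      "\<And>i. i \<in> {1..n} \<Longrightarrow> order_stat n (?e \<beta>) i = ?e \<beta> (q i)"
      using sorting_bijection[of n "?e \<beta>"] by metis
    \<comment> \<open>Compare \<open>s\<close>-th powers, which reflect the order because
      \<open>z k\<close> is nonnegative and \<open>s\<close> is positive.\<close>
    have le: "?e \<beta> k powr of_rat p \<le> z k" if k: "k \<in> {1..n}" for k
    proof -
      have "(?e \<beta> k powr of_rat p) ^ s = ?e \<beta> k ^ r"
        using pow[OF res(2)[OF \<beta> k]] by (simp add: p)
      also have "\<dots> \<le> \<epsilon> k ^ r"
        using \<epsilon> k res[OF \<beta> k] by (intro power_mono) auto
      also have "\<dots> \<le> z k ^ s"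
        using z\<epsilon> k by blast
      finally show ?thesis
        using z k assms(6) by (simp add: power_mono_iff)
    qed
    \<comment> \<open>Here \<open>q\<close> sorts the residuals and perhaps not \<open>z\<close>;
      weak duality allows this.\<close>
    have "fit_objective N n lam p x \<beta> \<le> (\<Sum>i=1..n. lam i * z (q i))"
      unfolding fit_objective_def using q le assms(3)
      by (intro sum_mono) (auto intro!: mult_left_mono dest!: bij_betwE)
    also have "\<dots> \<le> (\<Sum>j=1..n. v j) + (\<Sum>i=1..n. w i)"
      by (rule assignment_weak_duality[OF q(1) vw])
    finally show ?case
      using \<beta> by (simp add: b fit_feasible_def mp_objective_def)
  next
    case (2 \<beta>)
    then have \<beta>: "drop0 \<beta> \<noteq> 0"
      by (simp add: fit_feasible_def)
    obtain q where q: "bij_betw q {1..n} {1..n}"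
      "\<And>i. i \<in> {1..n} \<Longrightarrow> order_stat n (?e \<beta>) i = ?e \<beta> (q i)"
      "mono_on {1..n} (?e \<beta> \<circ> q)"
      using sorting_bijection[of n "?e \<beta>"] by metis
    \<comment> \<open>With the residuals as \<open>\<epsilon>\<close>, this is the least nonnegative
      \<open>z\<close> with \<open>z k ^ s \<ge> \<epsilon> k ^ r\<close>. A positive power is
      monotone on nonnegative reals, so \<open>q\<close> also sorts \<open>z\<close>, as strong
      duality requires.\<close>
    define z where "z k = ?e \<beta> k powr of_rat p" for k
    have "mono_on {1..n} (z \<circ> q)"
    proof (rule mono_onI)
      fix i j assume ij: "i \<in> {1..n}" "j \<in> {1..n}" "i \<le> j"
      then have "q i \<in> {1..n}"
        using q(1) by (auto dest: bij_betwE)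
      then show "(z \<circ> q) i \<le> (z \<circ> q) j"
        using mono_onD[OF q(3) ij] res(2)[OF \<beta>] by (simp add: z_def p powr_mono2)
    qed
    then obtain v w where vw: "\<forall>i\<in>{1..n}. \<forall>j\<in>{1..n}. lam i * z j \<le> v j + w i"
      "(\<Sum>j=1..n. v j) + (\<Sum>i=1..n. w i) = (\<Sum>i=1..n. lam i * z (q i))"
      using assignment_strong_duality[OF q(1) assms(4)] by blast
    have "(\<beta>, ?e \<beta>, z, v, w) \<in> mp_feasible N n lam r s x"
      using \<beta> vw(1) res[OF \<beta>] pow by (auto simp: mp_feasible_def z_def p)
    moreover have "mp_objective n (\<beta>, ?e \<beta>, z, v, w) = fit_objective N n lam p x \<beta>"
      using vw(2) q(2) by (simp add: mp_objective_def fit_objective_def z_def)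
    ultimately show ?case
      by (intro bexI[of _ "(\<beta>, ?e \<beta>, z, v, w)"]) auto
  }
qed

end
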